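(* Let $d\in\mathbb{N}$, $d\ge 1$, $p\in(1,\infty)$ and $m>0$ satisfy $m(p-1)>1$ and $dp>d+1$. Let $o\in\mathbb{R}^d$ and let $X$ be a probabilistically weak solution (as defined in the context) starting at $o$. For $R>0$ let $\tau_R:=\inf\{t\ge0:X_t\notin B_R(o)\}$. Then for every $R>0$ and every $t>0$, $$\mathbf{P}^o[\tau_R>t]\le\min\Big\{1,\ \frac{\omega_{d-1}C^\gamma}{d}\,t^{-d/\beta}\,R^d\Big\}.$$
   Context: $B_R(o)$ is the open Euclidean ball of radius $R$ and center $o$. Parameters: $\beta:=p+d(m(p-1)-1)$, $\gamma:=\frac{p-1}{m(p-1)-1}$, $\kappa:=\frac{m(p-1)-1}{mp}\beta^{-1/(p-1)}$, all positive. $\omega_{d-1}$ is the area of the unit sphere in $\mathbb{R}^d$ ($\omega_0=2$). Barenblatt profile: for $t>0$, $r\ge 0$, $S(t,r):=C-\kappa[t^{-1/\beta}r]^{p/(p-1)}$ and $U(t,r):=t^{-d/\beta}\,\max\{S(t,r),0\}^\gamma$, where $C>0$ is the unique constant (depending only on $d,p,m$) such that $\omega_{d-1}\int_0^\infty U(t,r)r^{d-1}\,\mathrm{d}r=1$ for every $t>0$. Put $\rho:=(C/\kappa)^{(p-1)/p}$; the support of $U(t,\cdot)$ is $[0,\rho t^{1/\beta}]$. The Barenblatt solution is $w^x(t,y):=U(t,|y-x|)$. Coefficients: for $0<r<\rho t^{1/\beta}$ let $a(t,r):=m^{p-1}|\partial_rU(t,r)|^{p-2}U(t,r)^{(m-1)(p-1)}$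 and $a_r:=\partial_r a$; set $a(t,r):=a_r(t,r):=0$ for $r\ge\rho t^{1/\beta}$ and for $r=0$. For $z\in\mathbb{R}^d$, $\mathrm{sgn}\,z:=z/|z|$ if $z\ne0$, $\mathrm{sgn}\,0:=0$. A stochastic basis is a complete probability space $(\Omega,\mathscr{F},\mathbf{P}^x)$ with a right-continuous filtration $\mathscr{F}_\bullet$ augmented by null sets; $\mathbf{E}^x$ denotes expectation. A probabilistically weak solution starting at $x\in\mathbb{R}^d$ is a continuous $\mathscr{F}_\bullet$-adapted $\mathbb{R}^d$-valued process $X$ on a stochastic basis carrying a standard $d$-dimensional $\mathscr{F}_\bullet$-Brownian motion $W$ such that (a) $\mathbf{E}^x[\int_0^t a(s,|X_s-x|)\,\mathrm{d}s]<\infty$ and $\mathbf{E}^x[\int_0^t|a_r(s,|X_s-x|)|\,\mathrm{d}s]<\infty$ for every $t>0$; (b) $\mathbf{P}^x$-a.s., for all $t\ge0$, $X_t=X_0+\int_0^t\sqrt{2a(s,|X_s-x|)}\,\mathrm{d}W_s+\int_0^t a_r(s,|X_s-x|)\,\mathrm{sgn}(X_s-x)\,\mathrm{d}s$; (c) for every $t>0$ the law of $X_t$ is $w^x(t,\cdot)\,\mathscr{L}^d$ ($\mathscr{L}^d$ Lebesgue measure); consequently $X_0=x$ a.s. *)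

theory Defs
  imports "HOL-Probability.Probability"
begin

section \<open>The Barenblatt profile\<close>

definition par_beta :: "nat \<Rightarrow> real \<Rightarrow> real \<Rightarrow> real" where
  "par_beta d p m = p + real d * (m * (p - 1) - 1)"

definition par_gamma :: "real \<Rightarrow> real \<Rightarrow> real" where
  "par_gamma p m = (p - 1) / (m * (p - 1) - 1)"

definition par_kappa :: "nat \<Rightarrow> real \<Rightarrow> real \<Rightarrow> real" where
  "par_kappa d p m = (m * (p - 1) - 1) / (m * p) * par_beta d p m powr (- 1 / (p - 1))"

text \<open>Area of the unit sphere of \<open>\<real>\<^sup>d\<close>; equals 2 for \<open>d = 1\<close>.\<close>

definition sphere_area :: "nat \<Rightarrow> real" where
  "sphere_area d = 2 * pi powr (real d / 2) / Gamma (real d / 2)"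

text \<open>The profile with an arbitrary value of the constant \<open>C\<close>, which is needed to state the
  normalisation that determines \<open>C\<close>.\<close>

definition profile_with :: "real \<Rightarrow> nat \<Rightarrow> real \<Rightarrow> real \<Rightarrow> real \<Rightarrow> real \<Rightarrow> real" where
  "profile_with C d p m t r =
     t powr (- real d / par_beta d p m) *
     max (C - par_kappa d p m * (t powr (- 1 / par_beta d p m) * r) powr (p / (p - 1))) 0
       powr par_gamma p m"

text \<open>For \<open>1 < p\<close>, \<open>0 < m\<close> and \<open>1 < m * (p - 1)\<close> the description is proper: by scaling, the
  mass of the profile does not depend on \<open>t\<close> and is a positive multiple of
  \<open>C powr (par_gamma p m + d * (p - 1) / p)\<close>.\<close>

definition par_C :: "nat \<Rightarrow> real \<Rightarrow> real \<Rightarrow> real" where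
  "par_C d p m = (THE C. C > 0 \<and>
     (\<forall>t>0. sphere_area d * (LINT r:{0..}|lborel. profile_with C d p m t r * r ^ (d - 1)) = 1))"

definition profile :: "nat \<Rightarrow> real \<Rightarrow> real \<Rightarrow> real \<Rightarrow> real \<Rightarrow> real" where
  "profile d p m = profile_with (par_C d p m) d p m"

definition par_rho :: "nat \<Rightarrow> real \<Rightarrow> real \<Rightarrow> real" where
  "par_rho d p m = (par_C d p m / par_kappa d p m) powr ((p - 1) / p)"

definition barenblatt :: "real \<Rightarrow> real \<Rightarrow> real ^ 'n \<Rightarrow> real \<Rightarrow> real ^ 'n \<Rightarrow> real" where
  "barenblatt p m x t y = profile CARD('n) p m t (norm (y - x))"

section \<open>The coefficients\<close>

definition coeff_a :: "nat \<Rightarrow> real \<Rightarrow> real \<Rightarrow> real \<Rightarrow> real \<Rightarrow> real" where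
  "coeff_a d p m t r =
     (if 0 < r \<and> r < par_rho d p m * t powr (1 / par_beta d p m)
      then m powr (p - 1) * \<bar>deriv (\<lambda>s. profile d p m t s) r\<bar> powr (p - 2)
             * profile d p m t r powr ((m - 1) * (p - 1))
      else 0)"

definition coeff_ar :: "nat \<Rightarrow> real \<Rightarrow> real \<Rightarrow> real \<Rightarrow> real \<Rightarrow> real" where
  "coeff_ar d p m t r =
     (if 0 < r \<and> r < par_rho d p m * t powr (1 / par_beta d p m)
      then deriv (\<lambda>s. coeff_a d p m t s) r else 0)"

section \<open>Stochastic bases, Brownian motion and the Ito integral\<close>

text \<open>The time set is \<open>[0,\<infinity>)\<close>; values of filtrations and processes at negative times are
  irrelevant throughout.\<close>

locale stochastic_basis = prob_space M + complete_measure M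
  for M :: "'w measure" and F :: "real \<Rightarrow> 'w measure" +
  assumes filtration: "filtration (space M) (\<lambda>t. F (max 0 t))"
    and subalgebra: "\<And>t. 0 \<le> t \<Longrightarrow> subalgebra M (F t)"
    and right_continuous: "\<And>t. 0 \<le> t \<Longrightarrow> sets (F t) = (\<Inter>s\<in>{t<..}. sets (F s))"
    and augmented: "null_sets M \<subseteq> sets (F 0)"

definition adapted :: "(real \<Rightarrow> 'w measure) \<Rightarrow> (real \<Rightarrow> 'w \<Rightarrow> 'b::topological_space) \<Rightarrow> bool" where
  "adapted F X \<longleftrightarrow> (\<forall>t\<ge>0. X t \<in> borel_measurable (F t))"

definition continuous_process ::
  "'w measure \<Rightarrow> (real \<Rightarrow> 'w \<Rightarrow> 'b::topological_space) \<Rightarrow> bool" where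
  "continuous_process M X \<longleftrightarrow> (\<forall>\<omega>\<in>space M. continuous_on {0..} (\<lambda>t. X t \<omega>))"

definition progressively_measurable ::
  "(real \<Rightarrow> 'w measure) \<Rightarrow> (real \<Rightarrow> 'w \<Rightarrow> 'b::topological_space) \<Rightarrow> bool" where
  "progressively_measurable F H \<longleftrightarrow>
     (\<forall>T\<ge>0. (\<lambda>(s, \<omega>). H s \<omega>) \<in> borel_measurable (restrict_space borel {0..T} \<Otimes>\<^sub>M F T))"

definition brownian_motion ::
  "'w measure \<Rightarrow> (real \<Rightarrow> 'w measure) \<Rightarrow> (real \<Rightarrow> 'w \<Rightarrow> real ^ 'n) \<Rightarrow> bool" where
  "brownian_motion M F W \<longleftrightarrow>
     adapted F W \<and> continuous_process M W \<and> (AE \<omega> in M. W 0 \<omega> = 0) \<and>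
     (\<forall>s t. 0 \<le> s \<and> s < t \<longrightarrow>
        distributed M lborel (\<lambda>\<omega>. W t \<omega> - W s \<omega>)
          (\<lambda>y. ennreal (\<Prod>i\<in>UNIV. normal_density 0 (sqrt (t - s)) (y $ i))) \<and>
        prob_space.indep_set M (sets (F s))
          (sets (vimage_algebra (space M) (\<lambda>\<omega>. W t \<omega> - W s \<omega>) borel)))"

text \<open>A simple integrand \<open>\<Sum>i<n. \<xi> i * indicator {u i<..u (Suc i)}\<close> with bounded
  \<open>F (u i)\<close>-measurable weights \<open>\<xi> i\<close>, and its elementary stochastic integral.\<close>

definition simple_data ::
  "'w measure \<Rightarrow> (real \<Rightarrow> 'w measure) \<Rightarrow> nat \<Rightarrow> (nat \<Rightarrow> real) \<Rightarrow> (nat \<Rightarrow> 'w \<Rightarrow> real) \<Rightarrow> bool" where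
  "simple_data M F n u \<xi> \<longleftrightarrow> 0 \<le> u 0 \<and>
     (\<forall>i<n. u i \<le> u (Suc i) \<and> \<xi> i \<in> borel_measurable (F (u i)) \<and>
            (\<exists>B. \<forall>\<omega>\<in>space M. \<bar>\<xi> i \<omega>\<bar> \<le> B))"

definition simple_process ::
  "nat \<Rightarrow> (nat \<Rightarrow> real) \<Rightarrow> (nat \<Rightarrow> 'w \<Rightarrow> real) \<Rightarrow> real \<Rightarrow> 'w \<Rightarrow> real" where
  "simple_process n u \<xi> t \<omega> = (\<Sum>i<n. \<xi> i \<omega> * indicator {u i<..u (Suc i)} t)"

definition simple_integral ::
  "(real \<Rightarrow> 'w \<Rightarrow> 'b::real_vector) \<Rightarrow> nat \<Rightarrow> (nat \<Rightarrow> real) \<Rightarrow> (nat \<Rightarrow> 'w \<Rightarrow> real) \<Rightarrow> real \<Rightarrow> 'w \<Rightarrow> 'b"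
  where
  "simple_integral W n u \<xi> t \<omega> =
     (\<Sum>i<n. \<xi> i \<omega> *\<^sub>R (W (min t (u (Suc i))) \<omega> - W (min t (u i)) \<omega>))"

text \<open>\<open>I\<close> is the (continuous version, hence unique up to indistinguishability, of the) Ito
  integral process of the scalar integrand \<open>H\<close> with respect to \<open>W\<close>: the \<open>L\<^sup>2\<close>-limit of the
  elementary integrals of simple integrands approximating \<open>H\<close> in \<open>L\<^sup>2([0,T] \<times> \<Omega>)\<close> for every
  \<open>T\<close>.  For a Brownian motion \<open>W\<close> and
  progressively measurable \<open>H\<close>, such an \<open>I\<close> exists precisely if \<open>H\<close> is square-integrable on every
  \<open>[0,T] \<times> \<Omega>\<close>.\<close>

definition is_ito_integral ::
  "'w measure \<Rightarrow> (real \<Rightarrow> 'w measure) \<Rightarrow> (real \<Rightarrow> 'w \<Rightarrow> real ^ 'n) \<Rightarrow> (real \<Rightarrow> 'w \<Rightarrow> real) \<Rightarrow>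
   (real \<Rightarrow> 'w \<Rightarrow> real ^ 'n) \<Rightarrow> bool" where
  "is_ito_integral M F W H I \<longleftrightarrow>
     progressively_measurable F H \<and> adapted F I \<and> continuous_process M I \<and>
     (\<exists>n u \<xi>. (\<forall>k. simple_data M F (n k) (u k) (\<xi> k)) \<and>
        (\<forall>T>0. (\<lambda>k. \<integral>\<^sup>+\<omega>. (\<integral>\<^sup>+s\<in>{0..T}.
                   ennreal ((H s \<omega> - simple_process (n k) (u k) (\<xi> k) s \<omega>)\<^sup>2) \<partial>lborel) \<partial>M)
                \<longlonglongrightarrow> 0) \<and>
        (\<forall>T>0. (\<lambda>k. \<integral>\<^sup>+\<omega>.
                   ennreal ((norm (I T \<omega> - simple_integral W (n k) (u k) (\<xi> k) T \<omega>))\<^sup>2) \<partial>M)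
                \<longlonglongrightarrow> 0))"

section \<open>Probabilistically weak solutions\<close>

definition weak_solution ::
  "real \<Rightarrow> real \<Rightarrow> 'w measure \<Rightarrow> (real \<Rightarrow> 'w measure) \<Rightarrow> (real \<Rightarrow> 'w \<Rightarrow> real ^ 'n) \<Rightarrow>
   (real \<Rightarrow> 'w \<Rightarrow> real ^ 'n) \<Rightarrow> real ^ 'n \<Rightarrow> bool" where
  "weak_solution p m M F W X x \<longleftrightarrow>
     stochastic_basis M F \<and> brownian_motion M F W \<and>
     adapted F X \<and> continuous_process M X \<and>
     (\<forall>t>0. (\<integral>\<^sup>+\<omega>. (\<integral>\<^sup>+s\<in>{0..t}.
               ennreal (coeff_a CARD('n) p m s (norm (X s \<omega> - x))) \<partial>lborel) \<partial>M) < \<infinity>) \<and>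
     (\<forall>t>0. (\<integral>\<^sup>+\<omega>. (\<integral>\<^sup>+s\<in>{0..t}.
               ennreal \<bar>coeff_ar CARD('n) p m s (norm (X s \<omega> - x))\<bar> \<partial>lborel) \<partial>M) < \<infinity>) \<and>
     (\<exists>I. is_ito_integral M F W
            (\<lambda>s \<omega>. sqrt (2 * coeff_a CARD('n) p m s (norm (X s \<omega> - x)))) I \<and>
          (AE \<omega> in M. \<forall>t\<ge>0. X t \<omega> = X 0 \<omega> + I t \<omega> +
             (LINT s:{0..t}|lborel.
                coeff_ar CARD('n) p m s (norm (X s \<omega> - x)) *\<^sub>R sgn (X s \<omega> - x)))) \<and>
     (\<forall>t>0. distributed M lborel (X t) (\<lambda>y. ennreal (barenblatt p m x t y)))"

definition exit_time :: "(real \<Rightarrow> 'w \<Rightarrow> 'b::metric_space) \<Rightarrow> 'b \<Rightarrow> real \<Rightarrow> 'w \<Rightarrow> ennreal" where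
  "exit_time X x R \<omega> = (INF t\<in>{t. 0 \<le> t \<and> X t \<omega> \<notin> ball x R}. ennreal t)"

end

theory Submission
  imports Defs
begin

text \<open>The functional equation of \<open>Gamma\<close> at \<open>d / 2\<close> supplies the
  factor \<open>d / 2\<close>. This turns the ball volume into the constant
  \<open>sphere_area d / d\<close> of the final bound.\<close>

lemma sphere_area_eq_unit_ball_vol:
  assumes "0 < d"
  shows "sphere_area d = real d * unit_ball_vol (real d)"
proof -
  have "Gamma (real d / 2 + 1) = real d / 2 * Gamma (real d / 2)"
    using assms by (intro Gamma_plus1) auto
  then have "unit_ball_vol (real d) = pi powr (real d / 2) / (real d / 2 * Gamma (real d / 2))"
    by (simp only: unit_ball_vol_def)
  then show ?thesis
    using assms by (simp add: sphere_area_def)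
qed

text \<open>The sign of \<open>C\<close> is irrelevant: for \<open>C \<le> 0\<close> the profile vanishes. Hence the bound also
  covers a possible junk value of \<open>THE\<close> in \<open>par_C\<close>.\<close>

lemma profile_with_le:
  assumes "1 < p" "0 < m" "1 < m * (p - 1)"
  shows "profile_with C d p m t r \<le> t powr (- real d / par_beta d p m) * C powr par_gamma p m"
proof -
  have "0 \<le> par_kappa d p m"
    using assms by (simp add: par_kappa_def)
  then have "0 \<le> par_kappa d p m * (t powr (- 1 / par_beta d p m) * r) powr (p / (p - 1))"
    by simp
  moreover have "0 < par_gamma p m"
    using assms by (simp add: par_gamma_def)
  ultimately have "max (C - par_kappa d p m * (t powr (- 1 / par_beta d p m) * r) powr (p / (p - 1))) 0
       powr par_gamma p m \<le> C powr par_gamma p m"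
    by (auto simp: max_def intro: powr_mono2)
  then show ?thesis
    unfolding profile_with_def by (rule mult_left_mono) simp
qed

text \<open>Integrate the pointwise bound on the density over \<open>A\<close>. Finiteness of
  \<open>emeasure lborel A\<close> matters because \<open>measure\<close> sends infinite volume to
  0.\<close>

lemma distributed_measure_le:
  assumes X: "distributed M lborel X f" and A: "A \<in> sets lborel"
    and fin: "emeasure lborel A < \<infinity>" and c: "0 \<le> c" and f: "\<And>y. f y \<le> ennreal c"
  shows "measure M (X -` A \<inter> space M) \<le> c * measure lborel A"
proof -
  have "emeasure M (X -` A \<inter> space M) = (\<integral>\<^sup>+y. f y * indicator A y \<partial>lborel)"
    using X A by (rule distributed_emeasure)
  also have "\<dots> \<le> (\<integral>\<^sup>+y. ennreal c * indicator A y \<partial>lborel)"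
    by (intro nn_integral_mono mult_right_mono f) simp
  also have "\<dots> = ennreal (c * measure lborel A)"
    using A fin c by (simp add: nn_integral_cmult_indicator emeasure_eq_ennreal_measure ennreal_mult)
  finally show ?thesis
    using c by (simp add: measure_def enn2real_leI)
qed

text \<open>If the path were outside the ball at time \<open>t\<close>, then \<open>t\<close> would
  be a candidate in the infimum. A path that never exits has exit time \<infinity>, the infimum of
  the empty set.\<close>

lemma less_exit_time_imp_in_ball:
  assumes "ennreal t < exit_time X x R \<omega>" "0 \<le> t"
  shows "X t \<omega> \<in> ball x R"
proof (rule ccontr)
  assume "X t \<omega> \<notin> ball x R"
  then have "exit_time X x R \<omega> \<le> ennreal t"
    unfolding exit_time_def using assms(2) by (intro INF_lower) simp
  with assms(1) show False by simp
qed

theorem proposition3p19: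
  fixes M :: "'w measure" and F :: "real \<Rightarrow> 'w measure"
    and W X :: "real \<Rightarrow> 'w \<Rightarrow> real ^ 'n" and x\<^sub>0 :: "real ^ 'n"
    and p m R t :: real and d :: nat
  assumes "d = CARD('n)"
    and "1 < p" and "0 < m" and "1 < m * (p - 1)" and "real d + 1 < real d * p"
    and "weak_solution p m M F W X x\<^sub>0"
    and "0 < R" and "0 < t"
  shows "measure M {\<omega> \<in> space M. ennreal t < exit_time X x\<^sub>0 R \<omega>}
    \<le> min 1 (sphere_area d * par_C d p m powr par_gamma p m / real d
               * t powr (- real d / par_beta d p m) * R ^ d)"
proof -
  \<comment> \<open>For \<open>0 < par_C d p m\<close> this is the peak
    \<open>profile d p m t 0\<close> of the density.\<close>
  let ?c = "t powr (- real d / par_beta d p m) * par_C d p m powr par_gamma p m"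
  let ?A = "{\<omega> \<in> space M. ennreal t < exit_time X x\<^sub>0 R \<omega>}"
  have d: "0 < d"
    using assms(1) by simp
  interpret stochastic_basis M F
    using assms(6) by (simp add: weak_solution_def)
  have law: "distributed M lborel (X t) (\<lambda>y. ennreal (barenblatt p m x\<^sub>0 t y))"
    using assms(6,8) by (simp add: weak_solution_def)
  \<comment> \<open>Survival up to time \<open>t\<close> is relaxed to the position at time
    \<open>t\<close>, whose law is known.\<close>
  have "?A \<subseteq> X t -` ball x\<^sub>0 R \<inter> space M"
    using assms(8) less_exit_time_imp_in_ball[of t X x\<^sub>0 R] by auto
  \<comment> \<open>Monotonicity asks for measurability of the larger event only, which follows from
    that of \<open>X t\<close>.\<close>
  then have "measure M ?A \<le> measure M (X t -` ball x\<^sub>0 R \<inter> space M)"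
    using distributed_measurable[OF law] by (intro finite_measure_mono) (auto intro: measurable_sets)
  also have "\<dots> \<le> ?c * measure lborel (ball x\<^sub>0 R)"
    using law
  proof (rule distributed_measure_le)
    show "ennreal (barenblatt p m x\<^sub>0 t y) \<le> ennreal ?c" for y
      using profile_with_le[OF assms(2-4)] assms(1)
      by (auto simp: barenblatt_def profile_def intro: ennreal_leI)
    show "emeasure lborel (ball x\<^sub>0 R) < \<infinity>"
      by (intro emeasure_bounded_finite bounded_ball)
  qed simp_all
  also have "measure lborel (ball x\<^sub>0 R) = unit_ball_vol (real d) * R ^ d"
    using assms(1,7) by (simp add: content_ball)
  \<comment> \<open>The factor \<open>d\<close> cancels against the division by \<open>d\<close>;
    the bound 1 holds for any probability.\<close>
  finally show ?thesis
    using d by (simp add: sphere_area_eq_unit_ball_vol mult_ac)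
qed

end
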